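(* Let $q$ be a prime power, $\mathbb{A}=\mathbb{F}_q[t]$, and let $f,g\in\mathbb{A}$ be non-constant polynomials. Then $(f,g)$ is a Chen pair if and only if $\deg f<\gamma(g)$.
   Context: $\mathbb{F}_q$ is the finite field with $q$ elements and $\mathbb{A}=\mathbb{F}_q[t]$. For a non-constant $f\in\mathbb{A}$, $\mathbb{A}_f=\mathbb{A}/f\mathbb{A}$ is the residue class ring modulo $f$, and $\mathcal{A}_f=\{h\in\mathbb{A}:\deg h<\deg f\}\cup\{0\}$, a complete set of representatives of the residue classes modulo $f$; for $h\in\mathcal{A}_f$, $\bar h$ denotes the residue class of $h$ modulo $f$. A function $\sigma:\mathbb{A}_f\to\mathbb{A}_g$ is a polynomial function if there is $F\in\mathbb{A}[x]$ such that $\sigma(\bar h)=F(h)\bmod g$ for all $h\in\mathcal{A}_f$. A function $\sigma:\mathbb{A}_f\to\mathbb{A}_g$ is called congruence preserving if for all $h_1,h_2\in\mathcal{A}_f$ and every $h\in\mathbb{A}$ dividing $g$, $h_1\equiv h_2\pmod h$ implies $\sigma(\bar h_1)\equiv\sigma(\bar h_2)\pmod h$ (here $h_1,h_2$ are regarded as elements of $\mathbb{A}$, and reduction modulo $h$ of elements of $\mathbb{A}_g$ is well defined since $h\mid g$). $(f,g)$ is a Chen pair if every congruence preserving function from $\mathbb{A}_f$ to $\mathbb{A}_g$ is a polynomial function. The function $\gamma:\mathbb{A}\setminus\mathbb{F}_q\to\mathbb{N}\cup\{\infty\}$ is defined as follows. For $P$ irreducible and $e\ge1$: if $q=2$, then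 $\gamma(P^e)=\infty$ if $e=1$, $\gamma(P^e)=\infty$ if $e=2$ and $\deg P=1$, and $\gamma(P^e)=\deg P+2$ otherwise; if $q>2$, then $\gamma(P^e)=\infty$ if $e=1$ and $\gamma(P^e)=\deg P+1$ otherwise. For any other non-constant polynomial $h$ with prime factorization $h=\beta Q_1^{k_1}\cdots Q_s^{k_s}$, $\beta\in\mathbb{F}_q^*$ ($Q_i$ pairwise distinct monic irreducible, $k_i\ge1$), $\gamma(h)=\min\{\gamma(Q_1^{k_1}),\dots,\gamma(Q_s^{k_s})\}$. *)

theory Defs
  imports
    "HOL-Computational_Algebra.Computational_Algebra"
    "HOL-Number_Theory.Cong"
    "HOL-Library.FuncSet"
    "HOL-Library.Extended_Nat"
    "HOL-Library.Cardinality"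
begin

text \<open>
  The field \<open>F_q\<close> is an arbitrary type \<open>'a\<close> of sort \<open>{field, finite}\<close>, with \<open>q = CARD('a)\<close>; the ring
  \<open>A = F_q[t]\<close> is \<open>'a poly\<close>, and \<open>A[x]\<close> is \<open>'a poly poly\<close>.  A residue class modulo \<open>f\<close> is an actual
  equivalence class of the congruence relation modulo \<open>f\<close>.
\<close>

definition cong_rel :: "'a::field poly \<Rightarrow> ('a poly \<times> 'a poly) set" where
  "cong_rel f = {(a, b). [a = b] (mod f)}"

definition residue_ring :: "'a::field poly \<Rightarrow> 'a poly set set" where
  "residue_ring f = UNIV // cong_rel f"

definition residue_class :: "'a::field poly \<Rightarrow> 'a poly \<Rightarrow> 'a poly set" where
  "residue_class f a = cong_rel f `` {a}"

definition representatives :: "'a::field poly \<Rightarrow> 'a poly set" where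
  "representatives f = {h. degree h < degree f} \<union> {0}"

definition polynomial_function ::
  "'a::field poly \<Rightarrow> 'a poly \<Rightarrow> ('a poly set \<Rightarrow> 'a poly set) \<Rightarrow> bool" where
  "polynomial_function f g \<sigma> \<longleftrightarrow>
     (\<exists>F :: 'a poly poly. \<forall>h\<in>representatives f.
        \<sigma> (residue_class f h) = residue_class g (poly F h))"

text \<open>
  For \<open>h dvd g\<close>, the image \<open>cong_rel h `` X\<close> of a residue class \<open>X\<close> modulo \<open>g\<close> is the residue class
  modulo \<open>h\<close> containing \<open>X\<close>, i.e. the reduction of \<open>X\<close> modulo \<open>h\<close>.
\<close>

definition congruence_preserving ::
  "'a::field poly \<Rightarrow> 'a poly \<Rightarrow> ('a poly set \<Rightarrow> 'a poly set) \<Rightarrow> bool" where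
  "congruence_preserving f g \<sigma> \<longleftrightarrow>
     (\<forall>h1\<in>representatives f. \<forall>h2\<in>representatives f. \<forall>h. h dvd g \<longrightarrow> [h1 = h2] (mod h) \<longrightarrow>
        cong_rel h `` \<sigma> (residue_class f h1) = cong_rel h `` \<sigma> (residue_class f h2))"

definition Chen_pair :: "'a::field poly \<Rightarrow> 'a poly \<Rightarrow> bool" where
  "Chen_pair f g \<longleftrightarrow>
     (\<forall>\<sigma> \<in> residue_ring f \<rightarrow> residue_ring g.
        congruence_preserving f g \<sigma> \<longrightarrow> polynomial_function f g \<sigma>)"

text \<open>The value of \<open>\<gamma>\<close> at \<open>P ^ e\<close>, for \<open>P\<close> irreducible and \<open>e \<ge> 1\<close>.\<close>

definition gamma_prime_power :: "'a::{field, finite} poly \<Rightarrow> nat \<Rightarrow> enat" where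
  "gamma_prime_power P e =
     (if CARD('a) = 2 then
        (if e = 1 then \<infinity> else if e = 2 \<and> degree P = 1 then \<infinity> else enat (degree P + 2))
      else
        (if e = 1 then \<infinity> else enat (degree P + 1)))"

text \<open>
  The pairs \<open>(Q, k)\<close> below are the monic irreducible factors \<open>Q\<close> of \<open>h\<close> with their exponents \<open>k\<close> in the
  prime factorization of \<open>h\<close>.  (The library's \<open>multiplicity\<close> and \<open>prime_factorization\<close> are not
  available on \<open>'a poly\<close> for an arbitrary field \<open>'a\<close>.)  The case of a prime power needs no separate
  treatment, as the minimum then ranges over a single value; see \<open>gamma_power_irreducible\<close>.  For
  constant \<open>h\<close>, where \<open>\<gamma>\<close> is not defined, the value is meaningless.
\<close>

definition prime_power_factors :: "'a::field poly \<Rightarrow> ('a poly \<times> nat) set" where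
  "prime_power_factors h =
     {(Q, k). irreducible Q \<and> lead_coeff Q = 1 \<and> k \<ge> 1 \<and> Q ^ k dvd h \<and> \<not> Q ^ (k + 1) dvd h}"

definition gamma :: "'a::{field, finite} poly \<Rightarrow> enat" where
  "gamma h = Min ((\<lambda>(Q, k). gamma_prime_power Q k) ` prime_power_factors h)"

lemma gamma_power_irreducible:
  fixes P :: "'a::{field, finite} poly"
  assumes P: "irreducible P" and e: "e \<ge> 1"
  shows "gamma (P ^ e) = gamma_prime_power P e"
proof -
  have P0: "P \<noteq> 0" and Pu: "\<not> is_unit P" using P by (auto simp: irreducible_def)
  define c where "c = lead_coeff P"
  define R where "R = smult (inverse c) P"
  have c0: "c \<noteq> 0" using P0 by (simp add: c_def)
  have PR: "P = smult c R" using c0 by (simp add: R_def)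
  have R1: "lead_coeff R = 1" using c0 by (simp add: R_def c_def)
  have deg: "degree R = degree P" using c0 by (simp add: R_def)
  have PdR: "P dvd R" by (simp add: R_def dvd_smult)
  have Ru: "\<not> is_unit R" using Pu PdR dvd_trans by blast
  have R: "irreducible R"
  proof (rule irreducibleI)
    show "R \<noteq> 0" using R1 by auto
    show "\<not> is_unit R" by (fact Ru)
    fix a b assume "R = a * b"
    then have "P = (smult c a) * b" using PR by simp
    then have "is_unit (smult c a) \<or> is_unit b" using P irreducibleD by blast
    then show "is_unit a \<or> is_unit b" by (metis dvd_smult_cancel c0 smult_dvd_iff)
  qed
  have powP: "P ^ e = smult (c ^ e) (R ^ e)" by (simp add: PR smult_power)
  have pow: "R ^ k dvd P ^ e \<longleftrightarrow> k \<le> e" for k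
  proof -
    have "R ^ k dvd P ^ e \<longleftrightarrow> R ^ k dvd R ^ e" using c0 by (simp add: powP dvd_smult_iff)
    also have "\<dots> \<longleftrightarrow> k \<le> e"
    proof
      assume dvd: "R ^ k dvd R ^ e"
      show "k \<le> e"
      proof (rule ccontr)
        assume "\<not> k \<le> e"
        then have "R ^ (e + 1) dvd R ^ k" by (intro le_imp_power_dvd) simp
        then have "R ^ (e + 1) dvd R ^ e" using dvd dvd_trans by blast
        then have "R ^ e * R dvd R ^ e * 1" by (simp only: power_add power_one_right mult_1_right)
        then have "is_unit R" using R1 by (subst (asm) dvd_mult_cancel_left) auto
        then show False using Ru by simp
      qed
    qed (rule le_imp_power_dvd)
    finally show ?thesis .
  qed
  have uniq: "Q = R" if Q: "irreducible Q" "lead_coeff Q = 1" "Q dvd P ^ e" for Q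
  proof -
    have "prime_elem Q" using Q(1) by (rule field_poly_irreducible_imp_prime)
    then have "Q dvd P" using Q(3) prime_elem_dvd_power by blast
    then have "Q dvd R" using PdR dvd_trans by blast
    then obtain k where k: "R = Q * k" by (rule dvdE)
    then have ku: "is_unit k" using R Q(1) irreducibleD irreducible_not_unit by blast
    then obtain d where d: "k = [:d:]" using is_unit_poly_iff by blast
    have "lead_coeff R = lead_coeff Q * lead_coeff k" by (simp add: k lead_coeff_mult)
    then have "d = 1" using R1 Q(2) d by simp
    then show ?thesis using k d by simp
  qed
  have "Q = R \<and> k = e" if "(Q, k) \<in> prime_power_factors (P ^ e)" for Q k
  proof -
    have Q: "irreducible Q" "lead_coeff Q = 1" "k \<ge> 1" "Q ^ k dvd P ^ e" "\<not> Q ^ (k + 1) dvd P ^ e"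
      using that by (auto simp: prime_power_factors_def)
    have "Q dvd Q ^ k" using Q(3) by (intro dvd_power) auto
    then have "Q dvd P ^ e" using Q(4) dvd_trans by blast
    then have "Q = R" using uniq Q by blast
    moreover have "k \<le> e" using Q(4) pow \<open>Q = R\<close> by blast
    moreover have "\<not> k + 1 \<le> e" using Q(5) pow \<open>Q = R\<close> by blast
    ultimately show ?thesis by linarith
  qed
  moreover have "(R, e) \<in> prime_power_factors (P ^ e)"
    using R R1 e pow[of e] pow[of "e + 1"] unfolding prime_power_factors_def
    by (simp del: power_Suc)
  ultimately have "prime_power_factors (P ^ e) = {(R, e)}" by fast
  then show ?thesis by (simp add: gamma_def gamma_prime_power_def deg)
qed

end

theory Submission
  imports Defs
begin

text \<open>
  By the Chinese remainder theorem interpolation is a question about prime powers \<open>P^e\<close>, and by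
  congruence preservation only arguments of degree less than \<open>e deg P\<close> matter.  Lagrange
  interpolation works as long as the arguments are distinct modulo \<open>P\<close>, which settles \<open>e = 1\<close> and
  \<open>deg f \<le> deg P\<close>.  For \<open>q = 2\<close> and \<open>deg f = deg P + 1\<close> the arguments come in pairs \<open>a, a + P\<close>, and
  congruence preservation supplies the factor \<open>P\<close> that a second interpolation step loses.  Conversely,
  modulo \<open>P^2\<close> a polynomial is affine on the multiples of \<open>P\<close>, whereas congruence preserving functions
  are not restricted there; three multiples \<open>0, P, cP\<close> with \<open>c\<close> not congruent to \<open>0, 1\<close> give a
  contradiction.  Such a \<open>c\<close> does not exist for \<open>q = 2\<close> and \<open>deg P = 1\<close>; the relation modulo \<open>P^3\<close>
  between the values at \<open>0, P, P^2, P + P^2\<close> then replaces it.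
\<close>

section \<open>Divisibility in polynomial rings over a field\<close>

text \<open>Euclid's algorithm: descent on the size of \<open>b\<close>, passing from
  \<open>(a, b)\<close> to \<open>(b, a mod b)\<close>.\<close>

lemma coprime_imp_bezout:
  fixes a b :: "'a::euclidean_ring"
  assumes "coprime a b"
  shows "\<exists>u v. u * a + v * b = 1"
  using assms
proof (induction "euclidean_size b" arbitrary: a b rule: less_induct)
  case less
  show ?case
  proof (cases "b = 0")
    case True
    then have "a dvd 1" using less.prems by simp
    then obtain u where "1 = a * u" by (rule dvdE)
    then have "u * a + 0 * b = 1" by (simp add: mult.commute)
    then show ?thesis by blast
  next
    case False
    have "coprime b (a mod b)"
    proof (rule coprimeI)
      fix d assume "d dvd b" "d dvd a mod b"
      then have "d dvd a" by (simp add: dvd_mod_iff)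
      then show "is_unit d" using less.prems \<open>d dvd b\<close> coprime_common_divisor by blast
    qed
    then obtain u v where "u * b + v * (a mod b) = 1"
      using less.hyps[of "a mod b" b] False mod_size_less by blast
    then have "v * a + (u - v * (a div b)) * b = 1"
      by (simp add: minus_div_mult_eq_mod[symmetric] algebra_simps)
    then show ?thesis by blast
  qed
qed

lemma irreducible_degree_pos:
  fixes P :: "'a::field poly"
  assumes "irreducible P"
  shows "degree P > 0"
  using assms by (auto simp: irreducible_def is_unit_iff_degree)

text \<open>Multiplying the Bezout identity for \<open>P ^ e\<close> and \<open>x\<close> by the one
  for \<open>P\<close> and \<open>x\<close> raises the exponent: every product term but one contains
  \<open>x\<close>.\<close>

lemma irreducible_power_bezout:
  fixes P x :: "'a::field poly"
  assumes P: "irreducible P" and x: "\<not> P dvd x"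
  shows "\<exists>u v. u * P ^ e + v * x = 1"
proof (induction e)
  case 0
  have "1 * P ^ 0 + 0 * x = 1" by simp
  then show ?case by blast
next
  case (Suc e)
  have "coprime P x"
    using P x by (meson coprimeI dvd_trans irreducibleD')
  then obtain a b where ab: "a * P + b * x = 1" using coprime_imp_bezout by blast
  obtain u v where uv: "u * P ^ e + v * x = 1" using Suc by blast
  have "(u * a) * P ^ Suc e + (u * P ^ e * b + v * a * P + v * x * b) * x
      = (u * P ^ e + v * x) * (a * P + b * x)"
    by (simp add: algebra_simps)
  also have "\<dots> = 1" by (simp add: ab uv)
  finally show ?case by blast
qed

lemma inverse_mod_irreducible_power:
  fixes P x y :: "'a::field poly"
  assumes "irreducible P" "\<not> P dvd x"
  shows "\<exists>c. [c * x = y] (mod P ^ e)"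
proof -
  obtain u v where uv: "u * P ^ e + v * x = 1"
    using irreducible_power_bezout[OF assms] by blast
  have "y * v * x = y * (u * P ^ e + v * x) - y * u * P ^ e" by (simp add: algebra_simps)
  then have "y * v * x - y = - y * u * P ^ e" by (simp add: uv)
  then have "P ^ e dvd y * v * x - y" by simp
  then show ?thesis by (auto simp: cong_iff_dvd_diff)
qed

text \<open>This dichotomy is what makes the obstructing functions congruence preserving. The
  induction strips one factor \<open>P\<close> from the product: from \<open>h\<close> if
  \<open>P\<close> divides \<open>h\<close>, otherwise from the cofactor, because \<open>P\<close>
  is prime.\<close>

lemma dvd_irreducible_power_mult:
  fixes P h m :: "'a::field poly"
  assumes P: "irreducible P" and "h dvd P ^ e * m"
  shows "P ^ Suc i dvd h \<or> h dvd P ^ i * m"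
  using assms(2)
proof (induction e arbitrary: h i)
  case 0
  then show ?case by simp
next
  case (Suc e)
  have P': "prime_elem P" using P by (rule field_poly_irreducible_imp_prime)
  have P0: "P \<noteq> 0" using P by auto
  show ?case
  proof (cases "P dvd h")
    case True
    then obtain h' where h: "h = P * h'" by (rule dvdE)
    have "h' dvd P ^ e * m" using Suc.prems P0 by (simp add: h mult.assoc)
    then have IH: "P ^ Suc j dvd h' \<or> h' dvd P ^ j * m" for j by (rule Suc.IH)
    show ?thesis
    proof (cases i)
      case 0
      then show ?thesis using True by simp
    next
      case (Suc j)
      then show ?thesis using IH[of j] P0 by (auto simp: h mult.assoc)
    qed
  next
    case False
    obtain k where k: "P ^ Suc e * m = h * k" using Suc.prems by (rule dvdE)
    have "P dvd h * k" by (simp flip: k)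
    then have "P dvd k" using False P' by (simp add: prime_elem_dvd_mult_iff)
    then obtain k' where k': "k = P * k'" by (rule dvdE)
    have "P * (P ^ e * m) = P * (h * k')" using k k' by (simp add: ac_simps)
    then have "h dvd P ^ e * m" using P0 by simp
    then show ?thesis by (rule Suc.IH)
  qed
qed

text \<open>A monic non-constant divisor of least degree works: a proper non-constant factor, made
  monic, would be smaller.\<close>

lemma exists_monic_irreducible_dvd:
  fixes g :: "'a::field poly"
  assumes "degree g > 0"
  obtains Q where "irreducible Q" "lead_coeff Q = 1" "Q dvd g"
proof -
  define S where "S p \<longleftrightarrow> degree p > 0 \<and> lead_coeff p = 1 \<and> p dvd g" for p
  have monic: "S (smult (inverse (lead_coeff p)) p)" if "degree p > 0" "p dvd g" for p
    using that by (auto simp: S_def smult_dvd_iff)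
  obtain Q where Q: "S Q" "\<And>p. S p \<Longrightarrow> degree Q \<le> degree p"
    using monic[OF assms] arg_min_natI[of S _ degree] arg_min_nat_le[of S _ degree]
    by (metis dvd_refl)
  have "irreducible Q"
  proof (rule irreducibleI)
    show "Q \<noteq> 0" using Q(1) by (auto simp: S_def)
    then show "\<not> is_unit Q" using Q(1) by (simp add: S_def is_unit_iff_degree)
    fix a b assume ab: "Q = a * b"
    then have nz: "a \<noteq> 0" "b \<noteq> 0" using Q(1) by (auto simp: S_def)
    show "is_unit a \<or> is_unit b"
    proof (cases "degree a > 0")
      case True
      have "a dvd g" using ab Q(1) by (auto simp: S_def elim: dvd_mult_left)
      from Q(2)[OF monic[OF True this]] have "degree Q \<le> degree a"
        using nz by simp
      then have "degree b = 0" using ab nz by (simp add: degree_mult_eq)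
      then show ?thesis using nz by (simp add: is_unit_iff_degree)
    next
      case False
      then show ?thesis using nz by (simp add: is_unit_iff_degree)
    qed
  qed
  then show ?thesis using Q(1) that by (auto simp: S_def)
qed

lemma irreducible_exact_power:
  fixes Q g :: "'a::field poly"
  assumes Q: "irreducible Q" and g: "g \<noteq> 0"
  obtains e m where "g = Q ^ e * m" "\<not> Q dvd m"
proof -
  have "\<exists>e m. g = Q ^ e * m \<and> \<not> Q dvd m"
    using g
  proof (induction "degree g" arbitrary: g rule: less_induct)
    case less
    show ?case
    proof (cases "Q dvd g")
      case True
      then obtain h where h: "g = Q * h" by (rule dvdE)
      have "degree h < degree g"
        using less.prems irreducible_degree_pos[OF Q] by (auto simp: h degree_mult_eq)
      then obtain e m where "h = Q ^ e * m" "\<not> Q dvd m"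
        using less.hyps[of h] less.prems h by auto
      then have "g = Q ^ Suc e * m" "\<not> Q dvd m" by (auto simp: h mult.assoc)
      then show ?thesis by blast
    next
      case False
      then have "g = Q ^ 0 * g \<and> \<not> Q dvd g" by simp
      then show ?thesis by blast
    qed
  qed
  then show ?thesis using that by blast
qed

lemma irreducible_power_dvd_exact:
  fixes Q m :: "'a::field poly"
  assumes Q: "irreducible Q" and m: "\<not> Q dvd m"
  shows "Q ^ k dvd Q ^ e * m \<longleftrightarrow> k \<le> e"
proof
  assume dvd: "Q ^ k dvd Q ^ e * m"
  show "k \<le> e"
  proof (rule ccontr)
    assume "\<not> k \<le> e"
    then have "Q ^ Suc e dvd Q ^ k" by (intro le_imp_power_dvd) simp
    then have "Q ^ e * Q dvd Q ^ e * m" using dvd dvd_trans by (metis power_Suc2)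
    then show False using Q m by (subst (asm) dvd_mult_cancel_left) auto
  qed
qed (simp add: le_imp_power_dvd)

lemma finite_degree_less:
  "finite {h :: 'a::{field, finite} poly. degree h < n}"
proof -
  have "{h :: 'a poly. degree h < n} \<subseteq> Poly ` {xs. set xs \<subseteq> UNIV \<and> length xs \<le> n}"
  proof
    fix h :: "'a poly" assume "h \<in> {h. degree h < n}"
    then have "length (coeffs h) \<le> n" by (cases "h = 0") (auto simp: length_coeffs_degree)
    then show "h \<in> Poly ` {xs. set xs \<subseteq> UNIV \<and> length xs \<le> n}"
      by (intro image_eqI[of _ _ "coeffs h"]) auto
  qed
  moreover have "finite {xs :: 'a list. set xs \<subseteq> UNIV \<and> length xs \<le> n}"
    by (rule finite_lists_length_le) simp
  ultimately show ?thesis by (meson finite_imageI finite_subset)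
qed

lemma prime_elem_dvd_prod:
  fixes p :: "'a::comm_semiring_1"
  assumes "prime_elem p" "p dvd prod f S"
  shows "\<exists>x\<in>S. p dvd f x"
  using assms
  by (induction S rule: infinite_finite_induct)
    (auto simp: prime_elem_dvd_mult_iff prime_elem_not_unit)

section \<open>Interpolation modulo a polynomial\<close>

text \<open>Residue classes are replaced by polynomials here: \<open>s\<close> gives lifts of the
  values, and only its values on the point set \<open>R\<close> matter.\<close>

definition congruence_preserving_on ::
  "'a::field poly set \<Rightarrow> 'a poly \<Rightarrow> ('a poly \<Rightarrow> 'a poly) \<Rightarrow> bool" where
  "congruence_preserving_on R g s \<longleftrightarrow>
     (\<forall>x\<in>R. \<forall>y\<in>R. \<forall>h. h dvd g \<longrightarrow> [x = y] (mod h) \<longrightarrow> [s x = s y] (mod h))"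

definition interpolable ::
  "'a::field poly set \<Rightarrow> 'a poly \<Rightarrow> ('a poly \<Rightarrow> 'a poly) \<Rightarrow> bool" where
  "interpolable R g s \<longleftrightarrow> (\<exists>F. \<forall>x\<in>R. [poly F x = s x] (mod g))"

lemma congruence_preserving_onD:
  assumes "congruence_preserving_on R g s" "x \<in> R" "y \<in> R" "h dvd g" "[x = y] (mod h)"
  shows "[s x = s y] (mod h)"
  using assms by (auto simp: congruence_preserving_on_def)

lemma congruence_preserving_on_dvd:
  assumes "congruence_preserving_on R g s" "h dvd g"
  shows "congruence_preserving_on R h s"
  using assms unfolding congruence_preserving_on_def by (meson dvd_trans)

lemma cong_poly_eval:
  fixes F :: "'a::field poly poly"
  assumes "[x = y] (mod m)"
  shows "[poly F x = poly F y] (mod m)"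
  by (induction F) (auto intro!: cong_add cong_mult assms)

lemma cong_dvd_modulus_poly:
  fixes x y m n :: "'a::field poly"
  assumes "[x = y] (mod m)" "n dvd m"
  shows "[x = y] (mod n)"
  using assms by (metis cong_iff_dvd_diff dvd_trans)

text \<open>Chinese remaindering of the interpolants: \<open>v * b\<close> is 1 modulo
  \<open>a\<close> and 0 modulo \<open>b\<close>, and \<open>u * a\<close> the reverse.\<close>

lemma interpolable_mult:
  fixes a b u v :: "'a::field poly"
  assumes "interpolable R a s" "interpolable R b s" and uv: "u * a + v * b = 1"
  shows "interpolable R (a * b) s"
proof -
  obtain F G where F: "\<And>x. x \<in> R \<Longrightarrow> [poly F x = s x] (mod a)"
    and G: "\<And>x. x \<in> R \<Longrightarrow> [poly G x = s x] (mod b)"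
    using assms(1,2) by (auto simp: interpolable_def)
  have "[poly (smult (v * b) F + smult (u * a) G) x = s x] (mod a * b)" if "x \<in> R" for x
  proof -
    have "a * b dvd v * (b * (poly F x - s x))" "a * b dvd u * (a * (poly G x - s x))"
      using F[OF that] G[OF that]
      by (auto simp: cong_iff_dvd_diff mult.commute[of a b] intro!: dvd_mult mult_dvd_mono)
    then have "a * b dvd v * (b * (poly F x - s x)) + u * (a * (poly G x - s x))"
      by (rule dvd_add)
    also have "\<dots> = v * b * poly F x + u * a * poly G x - (u * a + v * b) * s x"
      by (simp add: algebra_simps)
    finally show ?thesis by (simp add: uv cong_iff_dvd_diff)
  qed
  then show ?thesis unfolding interpolable_def by blast
qed

text \<open>Induction on the degree, splitting off the exact power of one irreducible factor.
  Quantifying over all powers dividing \<open>g\<close> lets the cofactor inherit the hypothesis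
  directly.\<close>

lemma interpolable_if_prime_powers:
  fixes g :: "'a::field poly"
  assumes "g \<noteq> 0"
    and "\<And>Q k. irreducible Q \<Longrightarrow> lead_coeff Q = 1 \<Longrightarrow> k \<ge> 1 \<Longrightarrow> Q ^ k dvd g \<Longrightarrow>
           interpolable R (Q ^ k) s"
  shows "interpolable R g s"
  using assms
proof (induction "degree g" arbitrary: g rule: less_induct)
  case less
  show ?case
  proof (cases "degree g = 0")
    case True
    then have "is_unit g" using less.prems(1) by (simp add: is_unit_iff_degree)
    then show ?thesis
      by (auto simp: interpolable_def cong_iff_dvd_diff intro: unit_imp_dvd)
  next
    case False
    then obtain Q where Q: "irreducible Q" "lead_coeff Q = 1" "Q dvd g"
      using exists_monic_irreducible_dvd[of g] by blast
    obtain e m where g: "g = Q ^ e * m" and m: "\<not> Q dvd m"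
      using irreducible_exact_power[OF Q(1) less.prems(1)] .
    have e: "e \<ge> 1" using Q(3) m by (cases e) (auto simp: g)
    have nz: "m \<noteq> 0" "Q \<noteq> 0" using less.prems(1) m Q(1) by auto
    have "degree m < degree g"
      using nz e irreducible_degree_pos[OF Q(1)] by (simp add: g degree_mult_eq degree_power_eq)
    then have "interpolable R m s"
      using less.hyps[of m] less.prems(2) nz by (simp add: g)
    moreover have "interpolable R (Q ^ e) s" using less.prems(2) Q e by (simp add: g)
    ultimately show ?thesis
      using interpolable_mult irreducible_power_bezout[OF Q(1) m] g by blast
  qed
qed

text \<open>Newton's scheme, adding one point at a time: the node polynomial of the earlier points
  is a unit modulo \<open>P ^ e\<close> at the new point, so any value can be corrected
  there.\<close>

lemma lagrange_mod_irreducible_power: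
  fixes P :: "'a::field poly"
  assumes P: "irreducible P" and "finite S"
    and "\<And>a b. a \<in> S \<Longrightarrow> b \<in> S \<Longrightarrow> P dvd a - b \<Longrightarrow> a = b"
  shows "interpolable S (P ^ e) s"
  using assms(2,3)
proof (induction S rule: finite_induct)
  case empty
  then show ?case by (simp add: interpolable_def)
next
  case (insert x S)
  then obtain F where F: "\<And>a. a \<in> S \<Longrightarrow> [poly F a = s a] (mod P ^ e)"
    by (auto simp: interpolable_def)
  define N where "N = (\<Prod>b\<in>S. [:- b, 1:])"
  have poly_N: "poly N y = (\<Prod>b\<in>S. y - b)" for y by (simp add: N_def poly_prod)
  have "\<not> P dvd poly N x"
    using prime_elem_dvd_prod[OF field_poly_irreducible_imp_prime[OF P]] insert.hyps insert.prems
    unfolding poly_N by blast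
  then obtain c where c: "[c * poly N x = s x - poly F x] (mod P ^ e)"
    using inverse_mod_irreducible_power[OF P] by blast
  have "[poly (F + smult c N) a = s a] (mod P ^ e)" if "a \<in> insert x S" for a
  proof (cases "a = x")
    case True
    then show ?thesis using c by (simp add: cong_iff_dvd_diff algebra_simps)
  next
    case False
    then have "poly N a = 0" using that insert.hyps by (auto simp: poly_N)
    then show ?thesis using F False that by simp
  qed
  then show ?case unfolding interpolable_def by blast
qed

text \<open>
  The node polynomial of \<open>S\<close> takes at \<open>a + P\<close> the value \<open>P\<close> times a unit modulo \<open>P\<close>; this is exactly
  enough to correct an interpolation on \<open>S\<close> by multiples of \<open>P\<close> at the points \<open>a + P\<close>.
\<close>

lemma lagrange_mod_irreducible_power_shift:
  fixes P :: "'a::field poly"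
  assumes P: "irreducible P" and S: "finite S"
    and inj: "\<And>a b. a \<in> S \<Longrightarrow> b \<in> S \<Longrightarrow> P dvd a - b \<Longrightarrow> a = b"
    and s: "\<And>a. a \<in> S \<Longrightarrow> [s (a + P) = s a] (mod P)"
  shows "interpolable (S \<union> (\<lambda>a. a + P) ` S) (P ^ e) s"
proof (cases "e = 0")
  case True
  then show ?thesis by (simp add: interpolable_def)
next
  case False
  have "interpolable S (P ^ e) s" using P S inj by (rule lagrange_mod_irreducible_power)
  then obtain F where F: "\<And>a. a \<in> S \<Longrightarrow> [poly F a = s a] (mod P ^ e)"
    by (auto simp: interpolable_def)
  define N where "N = (\<Prod>b\<in>S. [:- b, 1:])"
  have poly_N: "poly N y = (\<Prod>b\<in>S. y - b)" for y by (simp add: N_def poly_prod)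
  have "\<exists>w. [w * poly N (a + P) = s (a + P) - poly F (a + P)] (mod P ^ e)" if a: "a \<in> S" for a
  proof -
    \<comment> \<open>The factor at \<open>b = a\<close> is \<open>P\<close> itself; the remaining
      factors are prime to \<open>P\<close>.\<close>
    define M where "M = (\<Prod>b\<in>S - {a}. a + P - b)"
    have N: "poly N (a + P) = P * M" using S a by (simp add: poly_N M_def prod.remove)
    have "\<not> P dvd a + P - b" if "b \<in> S - {a}" for b
    proof
      assume "P dvd a + P - b"
      then have "P dvd a + P - b - P" by (rule dvd_diff) simp
      then show False using inj[OF a, of b] that by auto
    qed
    then have "\<not> P dvd M"
      using prime_elem_dvd_prod[OF field_poly_irreducible_imp_prime[OF P]] unfolding M_def by blast
    moreover have "P dvd s (a + P) - poly F (a + P)"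
    proof -
      \<comment> \<open>Modulo \<open>P\<close>, both \<open>F\<close> and \<open>s\<close> ignore
        the shift by \<open>P\<close>, so the error to be corrected is a multiple of
        \<open>P\<close>.\<close>
      have "[poly F (a + P) = poly F a] (mod P)"
        by (rule cong_poly_eval) (simp add: cong_iff_dvd_diff)
      also have "[poly F a = s a] (mod P)"
        using F[OF a] by (rule cong_dvd_modulus_poly) (use False in \<open>simp add: dvd_power\<close>)
      also have "[s a = s (a + P)] (mod P)" using s[OF a] by (rule cong_sym)
      finally show ?thesis by (simp add: cong_iff_dvd_diff dvd_diff_commute)
    qed
    then obtain r where r: "s (a + P) - poly F (a + P) = P * r" by (rule dvdE)
    ultimately obtain w where "[w * M = r] (mod P ^ e)"
      using inverse_mod_irreducible_power[OF P] by blast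
    then have "[P * (w * M) = P * r] (mod P ^ e)" by (rule cong_scalar_left)
    then have "[w * poly N (a + P) = s (a + P) - poly F (a + P)] (mod P ^ e)"
      unfolding N r by (simp only: mult.left_commute)
    then show ?thesis by blast
  qed
  then obtain w where w: "\<And>a. a \<in> S \<Longrightarrow>
      [w a * poly N (a + P) = s (a + P) - poly F (a + P)] (mod P ^ e)"
    by metis
  \<comment> \<open>The required multipliers \<open>w a\<close> are themselves interpolated at the
    shifted points; \<open>H * N\<close> then vanishes on \<open>S\<close> and gives the correction
    at \<open>a + P\<close>.\<close>
  have "interpolable ((\<lambda>a. a + P) ` S) (P ^ e) (\<lambda>x. w (x - P))"
    using inj by (intro lagrange_mod_irreducible_power[OF P]) (use S in auto)
  then obtain H where H: "\<And>a. a \<in> S \<Longrightarrow> [poly H (a + P) = w a] (mod P ^ e)"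
    by (auto simp: interpolable_def)
  have "[poly (F + H * N) a = s a] (mod P ^ e)" if "a \<in> S" for a
  proof -
    have "poly N a = 0" using S that by (auto simp: poly_N)
    then show ?thesis using F[OF that] by simp
  qed
  moreover have "[poly (F + H * N) (a + P) = s (a + P)] (mod P ^ e)" if "a \<in> S" for a
  proof -
    have "[poly H (a + P) * poly N (a + P) = w a * poly N (a + P)] (mod P ^ e)"
      using H[OF that] by (rule cong_scalar_right)
    also have "[w a * poly N (a + P) = s (a + P) - poly F (a + P)] (mod P ^ e)"
      by (rule w[OF that])
    finally show ?thesis by (simp add: cong_iff_dvd_diff algebra_simps)
  qed
  ultimately show ?thesis unfolding interpolable_def by (intro exI[of _ "F + H * N"]) blast
qed

section \<open>Obstructions to interpolation\<close>

text \<open>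
  The obstructing function is \<open>m P^(j-1)\<close> times the indicator of the multiples of \<open>P^j\<close>, where
  \<open>g = P^e m\<close> with \<open>m\<close> prime to \<open>P\<close>.
\<close>

lemma congruence_preserving_indicator:
  fixes P g :: "'a::field poly"
  assumes P: "irreducible P" and g: "g \<noteq> 0" and j: "j \<ge> 1"
  obtains s where "\<And>R. congruence_preserving_on R g s"
    "\<And>x. \<not> P ^ j dvd x \<Longrightarrow> s x = 0" "\<not> P ^ j dvd s 0"
proof -
  obtain e m where gm: "g = P ^ e * m" and m: "\<not> P dvd m"
    using irreducible_exact_power[OF P g] .
  obtain i where i: "j = Suc i" using j by (cases j) auto
  define s where "s x = (if P ^ j dvd x then P ^ i * m else 0)" for x
  have "[s x = s y] (mod h)" if h: "h dvd g" and xy: "[x = y] (mod h)" for x y h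
    \<comment> \<open>Either \<open>P ^ j\<close> divides \<open>h\<close>, and the indicator
      depends only on the class modulo \<open>h\<close>, or \<open>h\<close> divides
      \<open>P ^ i * m\<close>, and all values vanish modulo \<open>h\<close>.\<close>
    using dvd_irreducible_power_mult[OF P h[unfolded gm], of i]
  proof
    assume "P ^ Suc i dvd h"
    then have "[x = y] (mod P ^ j)" using cong_dvd_modulus_poly[OF xy] by (simp add: i)
    then have "P ^ j dvd x \<longleftrightarrow> P ^ j dvd y" by (rule cong_dvd_iff)
    then show ?thesis by (simp add: s_def)
  next
    assume "h dvd P ^ i * m"
    then have "h dvd s x" "h dvd s y" by (auto simp: s_def)
    then show ?thesis by (simp add: cong_iff_dvd_diff)
  qed
  then have "congruence_preserving_on R g s" for R by (simp add: congruence_preserving_on_def)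
  moreover have "\<not> P ^ j dvd s 0"
    using irreducible_power_dvd_exact[OF P m, of j i] by (simp add: s_def i)
  moreover have "s x = 0" if "\<not> P ^ j dvd x" for x using that by (simp add: s_def)
  ultimately show ?thesis using that by blast
qed

text \<open>Vanishing at \<open>P\<close> and \<open>c * P\<close> forces the slope of the affine
  function to be divisible by \<open>P\<close>, hence its constant term by \<open>P ^ 2\<close>,
  against the value at 0. The condition on \<open>c\<close> keeps \<open>c * P\<close> off the
  multiples of \<open>P ^ 2\<close>, that on \<open>c - 1\<close> lets the slope be
  isolated.\<close>

lemma not_interpolable_square_dvd:
  fixes P g c :: "'a::field poly"
  assumes P: "irreducible P" and g: "g \<noteq> 0" "P ^ 2 dvd g"
    and c: "\<not> P dvd c" "\<not> P dvd c - 1" and R: "0 \<in> R" "P \<in> R" "c * P \<in> R"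
  shows "\<exists>s. congruence_preserving_on R g s \<and> \<not> interpolable R g s"
proof -
  obtain s where s: "\<And>R. congruence_preserving_on R g s"
    "\<And>x. \<not> P ^ 2 dvd x \<Longrightarrow> s x = 0" "\<not> P ^ 2 dvd s 0"
    using congruence_preserving_indicator[OF P g(1), of 2, OF one_le_numeral] by blast
  have P': "prime_elem P" using P by (rule field_poly_irreducible_imp_prime)
  have P0: "P \<noteq> 0" using P by auto
  have "\<not> P dvd 1" using P by (simp add: irreducible_def)
  then have sP: "s P = 0" "s (c * P) = 0"
    using c(1) P0 by (auto intro!: s(2) simp: power2_eq_square)
  have False if I: "interpolable R g s"
  proof -
    obtain F where "\<And>x. x \<in> R \<Longrightarrow> [poly F x = s x] (mod g)"
      using I by (auto simp: interpolable_def)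
    then have F: "[poly F x = s x] (mod P ^ 2)" if "x \<in> R" for x
      using that g(2) by (blast intro: cong_dvd_modulus_poly)
    obtain a b G where "F = pCons a (pCons b G)" by (metis pCons_cases)
    then have poly_F: "poly F x = a + b * x + x ^ 2 * poly G x" for x
      by (simp add: algebra_simps power2_eq_square)
    have lin: "P ^ 2 dvd a + b * (d * P)" if "d * P \<in> R" "s (d * P) = 0" for d
    proof -
      have "P ^ 2 dvd poly F (d * P) - (d * P) ^ 2 * poly G (d * P)"
        using F[OF that(1)] that(2)
        by (intro dvd_diff) (auto simp: cong_iff_dvd_diff power_mult_distrib)
      then show ?thesis by (simp add: poly_F)
    qed
    have 1: "P ^ 2 dvd a + b * P" using lin[of 1] R sP by simp
    moreover have "P ^ 2 dvd a + b * (c * P)" using lin[of c] R sP by simp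
    ultimately have "P ^ 2 dvd (a + b * (c * P)) - (a + b * P)" by (rule dvd_diff[rotated])
    also have "\<dots> = (c - 1) * b * P" by (simp add: algebra_simps)
    finally have "P dvd (c - 1) * b" using P0 by (simp add: power2_eq_square)
    then have "P dvd b" using P' c(2) by (simp add: prime_elem_dvd_mult_iff)
    then have "P ^ 2 dvd b * P" by (simp add: power2_eq_square)
    then have "P ^ 2 dvd a" using 1 by (metis dvd_add_left_iff)
    moreover have "[a = s 0] (mod P ^ 2)" using F[OF R(1)] by (simp add: poly_F)
    ultimately show False using s(3) cong_dvd_iff by blast
  qed
  then show ?thesis using s(1) by blast
qed

text \<open>
  In characteristic 2, every \<open>F\<close> satisfies \<open>F(0) + F(P) + F(P^2) + F(P + P^2) = 0\<close> modulo \<open>P^3\<close>.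
\<close>

lemma not_interpolable_cube_dvd:
  fixes P g :: "'a::field poly"
  assumes P: "irreducible P" and g: "g \<noteq> 0" "P ^ 3 dvd g" and two: "(1 :: 'a) + 1 = 0"
    and R: "0 \<in> R" "P \<in> R" "P ^ 2 \<in> R" "P + P ^ 2 \<in> R"
  shows "\<exists>s. congruence_preserving_on R g s \<and> \<not> interpolable R g s"
proof -
  obtain s where s: "\<And>R. congruence_preserving_on R g s"
    "\<And>x. \<not> P ^ 3 dvd x \<Longrightarrow> s x = 0" "\<not> P ^ 3 dvd s 0"
    using congruence_preserving_indicator[OF P g(1), of 3, OF one_le_numeral] by blast
  have P0: "P \<noteq> 0" using P by auto
  have P1: "\<not> P dvd 1" using P by (simp add: irreducible_def)
  have "\<not> P dvd 1 + P" using P1 by (simp add: dvd_add_left_iff)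
  \<comment> \<open>The three nonzero arguments contain exactly 1, 2 and 1 factors \<open>P\<close>,
    so the indicator of the multiples of \<open>P ^ 3\<close> vanishes at them.\<close>
  then have "\<not> P ^ 3 dvd P ^ 1 * 1" "\<not> P ^ 3 dvd P ^ 2 * 1" "\<not> P ^ 3 dvd P ^ 1 * (1 + P)"
    using irreducible_power_dvd_exact[OF P P1, of 3]
      irreducible_power_dvd_exact[OF P, of "1 + P" 3 1] by auto
  then have sP: "s P = 0" "s (P ^ 2) = 0" "s (P + P ^ 2) = 0"
    by (auto intro!: s(2) simp: algebra_simps power2_eq_square)
  have False if I: "interpolable R g s"
  proof -
    obtain F where "\<And>x. x \<in> R \<Longrightarrow> [poly F x = s x] (mod g)"
      using I by (auto simp: interpolable_def)
    then have F: "[poly F x = s x] (mod P ^ 3)" if "x \<in> R" for x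
      using that g(2) by (blast intro: cong_dvd_modulus_poly)
    obtain a b c G where "F = pCons a (pCons b (pCons c G))" by (metis pCons_cases)
    then have poly_F: "poly F x = a + b * x + c * x ^ 2 + x ^ 3 * poly G x" for x
      by (simp add: algebra_simps power2_eq_square power3_eq_cube)
    have cut: "P ^ 3 dvd a + b * x + c * x ^ 2" if "x \<in> R" "P dvd x" "s x = 0" for x
    proof -
      have "P ^ 3 dvd poly F x - x ^ 3 * poly G x"
        using F[OF that(1)] that(2,3)
        by (intro dvd_diff) (auto simp: cong_iff_dvd_diff intro: dvd_mult2 dvd_power_same)
      then show ?thesis by (simp add: poly_F)
    qed
    have "(1 :: 'a poly) + 1 = [:1 + 1:]" by (simp add: one_pCons)
    then have two': "(1 :: 'a poly) + 1 = 0" using two by simp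
    have double: "x + x = 0" for x :: "'a poly"
      using two' by (metis distrib_left mult_1_right mult_zero_right)
    have P2: "P dvd P ^ 2" by (simp add: power2_eq_square)
    \<comment> \<open>In the sum over the three nonzero arguments every term except one copy of
      \<open>a\<close> occurs in pairs.\<close>
    have "P ^ 3 dvd (a + b * P + c * P ^ 2) + (a + b * P ^ 2 + c * (P ^ 2) ^ 2)
        + (a + b * (P + P ^ 2) + c * (P + P ^ 2) ^ 2)"
      using P2 by (intro dvd_add cut R sP) auto
    also have "\<dots> = a + (a + a) + (b * P + b * P) + (b * P ^ 2 + b * P ^ 2)
        + (c * P ^ 2 + c * P ^ 2) + (c * P ^ 4 + c * P ^ 4) + (c * P ^ 3 + c * P ^ 3)"
      by (simp add: algebra_simps power2_eq_square power3_eq_cube power4_eq_xxxx)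
    also have "\<dots> = a" by (simp only: double add_0_right)
    finally have "P ^ 3 dvd a" .
    moreover have "[a = s 0] (mod P ^ 3)" using F[OF R(1)] by (simp add: poly_F)
    ultimately show False using s(3) cong_dvd_iff by blast
  qed
  then show ?thesis using s(1) by blast
qed

section \<open>Chen pairs and the function \<open>\<gamma>\<close>\<close>

lemma residue_class_eq_iff: "residue_class g a = residue_class g b \<longleftrightarrow> [a = b] (mod g)"
  by (auto simp: residue_class_def cong_rel_def cong_def)

lemma cong_rel_image_residue_class:
  assumes "h dvd g"
  shows "cong_rel h `` residue_class g a = residue_class h a"
proof -
  have "[a = c] (mod h)" if "[a = b] (mod g)" "[b = c] (mod h)" for b c
    using cong_dvd_modulus_poly[OF that(1) assms] that(2) by (rule cong_trans)
  moreover have "[a = a] (mod g)" by simp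
  ultimately show ?thesis unfolding residue_class_def cong_rel_def by blast
qed

text \<open>A map of residue classes and a lift \<open>s\<close> to representatives determine each
  other modulo \<open>g\<close>. Since \<open>f\<close> is non-constant, the degree bound already
  admits 0.\<close>

lemma Chen_pair_iff:
  fixes f g :: "'a::field poly"
  assumes f: "degree f > 0"
  shows "Chen_pair f g \<longleftrightarrow> (\<forall>s. congruence_preserving_on {h. degree h < degree f} g s \<longrightarrow>
           interpolable {h. degree h < degree f} g s)" (is "_ \<longleftrightarrow> (\<forall>s. ?C s \<longrightarrow> ?I s)")
proof -
  have reps: "representatives f = {h. degree h < degree f}"
    using f by (auto simp: representatives_def)
  have cp: "congruence_preserving f g \<sigma> \<longleftrightarrow> ?C s" and pf: "polynomial_function f g \<sigma> \<longleftrightarrow> ?I s"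
    if "\<forall>h. degree h < degree f \<longrightarrow> \<sigma> (residue_class f h) = residue_class g (s h)" for \<sigma> s
  proof -
    show "congruence_preserving f g \<sigma> \<longleftrightarrow> ?C s"
      using that unfolding congruence_preserving_def congruence_preserving_on_def reps
      by (simp add: cong_rel_image_residue_class residue_class_eq_iff cong: imp_cong)
    show "polynomial_function f g \<sigma> \<longleftrightarrow> ?I s"
      using that unfolding polynomial_function_def interpolable_def reps
      by (simp add: residue_class_eq_iff cong_sym_eq)
  qed
  show ?thesis
  proof
    assume Chen: "Chen_pair f g"
    show "\<forall>s. ?C s \<longrightarrow> ?I s"
    proof (intro allI impI)
      fix s assume s: "?C s"
      \<comment> \<open>All elements of a class have the same remainder modulo \<open>f\<close>, so
        the arbitrary choice is harmless.\<close>
      define \<sigma> where "\<sigma> X = residue_class g (s ((SOME x. x \<in> X) mod f))" for X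
      have "\<sigma> (residue_class f h) = residue_class g (s h)" if "degree h < degree f" for h
      proof -
        have "h \<in> residue_class f h" by (simp add: residue_class_def cong_rel_def)
        then have "(SOME x. x \<in> residue_class f h) \<in> residue_class f h" by (rule someI)
        then have "(SOME x. x \<in> residue_class f h) mod f = h mod f"
          by (simp add: residue_class_def cong_rel_def cong_def)
        then show ?thesis using that by (simp add: \<sigma>_def mod_poly_less)
      qed
      moreover have "\<sigma> \<in> residue_ring f \<rightarrow> residue_ring g"
        by (auto simp: \<sigma>_def residue_ring_def residue_class_def quotient_def)
      ultimately show "?I s" using Chen cp pf s unfolding Chen_pair_def by blast
    qed
  next
    assume *: "\<forall>s. ?C s \<longrightarrow> ?I s"
    show "Chen_pair f g"
      unfolding Chen_pair_def
    proof (intro ballI impI)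
      fix \<sigma> assume \<sigma>: "\<sigma> \<in> residue_ring f \<rightarrow> residue_ring g" "congruence_preserving f g \<sigma>"
      have "\<exists>a. \<sigma> (residue_class f h) = residue_class g a" for h
      proof -
        have "residue_class f h \<in> residue_ring f"
          by (auto simp: residue_ring_def residue_class_def quotient_def)
        then have "\<sigma> (residue_class f h) \<in> residue_ring g" using \<sigma>(1) by blast
        then show ?thesis by (auto simp: residue_ring_def residue_class_def quotient_def)
      qed
      then obtain s where "\<And>h. \<sigma> (residue_class f h) = residue_class g (s h)" by metis
      then show "polynomial_function f g \<sigma>" using * \<sigma>(2) cp pf by blast
    qed
  qed
qed

text \<open>\<open>Min\<close> is meaningful because the set of factors is finite,
  \<open>degree Q\<close> and \<open>k\<close> being at most \<open>degree g\<close>, and nonempty,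
  \<open>g\<close> being non-constant.\<close>

lemma less_gamma_iff:
  fixes g :: "'a::{field, finite} poly"
  assumes g: "degree g > 0"
  shows "n < gamma g \<longleftrightarrow> (\<forall>(Q, k)\<in>prime_power_factors g. n < gamma_prime_power Q k)"
proof -
  have g0: "g \<noteq> 0" using g by auto
  have "prime_power_factors g \<subseteq> {h. degree h < Suc (degree g)} \<times> {..degree g}"
  proof
    fix x assume "x \<in> prime_power_factors g"
    then obtain Q k where x: "x = (Q, k)" "irreducible Q" "k \<ge> 1" "Q ^ k dvd g"
      by (auto simp: prime_power_factors_def)
    then have Q0: "Q \<noteq> 0" by auto
    have "degree (Q ^ k) \<le> degree g" using x(4) g0 by (rule dvd_imp_degree_le)
    then have "k * degree Q \<le> degree g" using Q0 by (simp add: degree_power_eq)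
    moreover have "degree Q \<le> k * degree Q" "k \<le> k * degree Q"
      using x(3) irreducible_degree_pos[OF x(2)] by auto
    ultimately have "degree Q \<le> degree g" "k \<le> degree g" using le_trans by blast+
    then show "x \<in> {h. degree h < Suc (degree g)} \<times> {..degree g}"
      using x(1) by auto
  qed
  then have fin: "finite (prime_power_factors g)"
    by (rule finite_subset) (simp add: finite_degree_less)
  obtain Q where Q: "irreducible Q" "lead_coeff Q = 1" "Q dvd g"
    using exists_monic_irreducible_dvd[OF g] .
  obtain e m where gm: "g = Q ^ e * m" and m: "\<not> Q dvd m"
    using irreducible_exact_power[OF Q(1) g0] .
  have "e \<ge> 1" using Q(3) m by (cases e) (auto simp: gm)
  then have "(Q, e) \<in> prime_power_factors g"
    using Q(1,2) irreducible_power_dvd_exact[OF Q(1) m]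
    by (simp add: prime_power_factors_def gm del: power_Suc)
  then show ?thesis using fin unfolding gamma_def by (subst Min_gr_iff) auto
qed

section \<open>Interpolation at one prime power on either side of \<open>gamma\<close>\<close>

lemma inj_mod_irreducible:
  fixes P :: "'a::field poly"
  assumes "degree a < degree P" "degree b < degree P" "P dvd a - b"
  shows "a = b"
  using assms by (metis degree_diff_less dvd_imp_degree_le eq_iff_diff_eq_0 not_le)

text \<open>Replacing an argument by its remainder modulo \<open>g\<close> changes neither
  \<open>F\<close> nor \<open>s\<close> modulo \<open>g\<close>, and the remainder still has degree
  less than \<open>n\<close>.\<close>

lemma interpolable_reduce:
  fixes g :: "'a::field poly"
  assumes s: "congruence_preserving_on {h. degree h < n} g s" and g: "degree g > 0"
    and I: "interpolable {h. degree h < min n (degree g)} g s"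
  shows "interpolable {h. degree h < n} g s"
proof -
  obtain F where F: "\<And>h. degree h < min n (degree g) \<Longrightarrow> [poly F h = s h] (mod g)"
    using I by (auto simp: interpolable_def)
  have "[poly F h = s h] (mod g)" if h: "degree h < n" for h
  proof -
    have mod: "[h mod g = h] (mod g)" by simp
    have "degree (h mod g) < degree g" using g degree_mod_less[of g h] by (cases "g = 0"; cases "h mod g = 0") auto
    moreover have "degree (h mod g) < n"
      using h calculation mod_poly_less[of h g] by (cases "degree h < degree g") auto
    ultimately have *: "degree (h mod g) < min n (degree g)" by simp
    have "[poly F h = poly F (h mod g)] (mod g)" using cong_poly_eval[OF mod] by (rule cong_sym)
    also have "[poly F (h mod g) = s (h mod g)] (mod g)" using * by (rule F)
    also have "[s (h mod g) = s h] (mod g)"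
      using congruence_preserving_onD[OF s _ _ _ mod] h * by simp
    finally show ?thesis .
  qed
  then show ?thesis unfolding interpolable_def by blast
qed

lemma interpolable_degree_le:
  fixes P :: "'a::{field, finite} poly"
  assumes "irreducible P" "n \<le> degree P"
  shows "interpolable {h. degree h < n} (P ^ k) s"
  using assms finite_degree_less inj_mod_irreducible[of _ P]
  by (intro lagrange_mod_irreducible_power) auto

lemma card2_eq_0_or_1:
  fixes x :: "'a::{field, finite}"
  assumes "CARD('a) = 2"
  shows "x = 0 \<or> x = 1"
proof -
  have "{0, 1 :: 'a} = UNIV" using assms by (intro card_subset_eq) auto
  then show ?thesis by blast
qed

text \<open>Over two elements every leading coefficient is 1, so the polynomials of degree
  \<open>degree P\<close> are exactly the shifts \<open>a + P\<close> with
  \<open>degree a < degree P\<close>.\<close>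

lemma interpolable_degree_Suc:
  fixes P :: "'a::{field, finite} poly"
  assumes q: "CARD('a) = 2" and P: "irreducible P" and k: "k \<ge> 1"
    and s: "congruence_preserving_on {h. degree h < degree P + 1} (P ^ k) s"
  shows "interpolable {h. degree h < degree P + 1} (P ^ k) s"
proof -
  let ?S = "{h. degree h < degree P}"
  have "[s (a + P) = s a] (mod P)" if "a \<in> ?S" for a
    using that k
    by (intro congruence_preserving_onD[OF s]) (auto simp: cong_iff_dvd_diff degree_add_eq_right)
  then have I: "interpolable (?S \<union> (\<lambda>a. a + P) ` ?S) (P ^ k) s"
    using finite_degree_less inj_mod_irreducible[of _ P]
    by (intro lagrange_mod_irreducible_power_shift[OF P]) auto
  have "{h. degree h < degree P + 1} \<subseteq> ?S \<union> (\<lambda>a. a + P) ` ?S"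
  proof
    fix h :: "'a poly" assume "h \<in> {h. degree h < degree P + 1}"
    then have h: "degree h \<le> degree P" by simp
    show "h \<in> ?S \<union> (\<lambda>a. a + P) ` ?S"
    proof (cases "degree h = degree P")
      case True
      have "P \<noteq> 0" "h \<noteq> 0" using P True irreducible_degree_pos[OF P] by auto
      then have "lead_coeff h = lead_coeff P"
        using card2_eq_0_or_1[OF q, of "lead_coeff h"] card2_eq_0_or_1[OF q, of "lead_coeff P"]
        by auto
      then have "degree (h - P) < degree P"
        using True irreducible_degree_pos[OF P]
        by (metis coeff_diff degree_0 degree_diff_le leading_coeff_0_iff diff_self le_neq_implies_less order_refl)
      then have "h - P \<in> ?S" by simp
      then have "h - P + P \<in> (\<lambda>a. a + P) ` ?S" by blast
      then show ?thesis by simp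
    qed (use h in auto)
  qed
  then show ?thesis using I unfolding interpolable_def by blast
qed

text \<open>Here \<open>e\<close> stands for the exact exponent of \<open>Q\<close> in
  \<open>g\<close>, where \<open>gamma\<close> is read off, and \<open>k\<close> for any smaller or
  equal exponent.\<close>

lemma interpolable_below_gamma:
  fixes Q :: "'a::{field, finite} poly"
  assumes Q: "irreducible Q" and n: "enat n < gamma_prime_power Q e" and k: "1 \<le> k" "k \<le> e"
    and s: "congruence_preserving_on {h. degree h < n} (Q ^ k) s"
  shows "interpolable {h. degree h < n} (Q ^ k) s"
proof -
  have d: "degree Q > 0" using Q by (rule irreducible_degree_pos)
  then have Q0: "Q \<noteq> 0" by auto
  have deg: "degree (Q ^ k) = k * degree Q" using Q0 by (simp add: degree_power_eq)
  consider "n \<le> degree Q" | "k = 1" | "CARD('a) = 2" "n = degree Q + 1"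
    | "CARD('a) = 2" "k = 2" "degree Q = 1" "n > 1"
    using n k by (fastforce simp: gamma_prime_power_def split: if_splits)
  then show ?thesis
  proof cases
    case 1
    then show ?thesis using Q by (rule interpolable_degree_le[rotated])
  next
    case 2
    have "interpolable {h. degree h < min n (degree Q)} (Q ^ k) s"
      using Q by (rule interpolable_degree_le) simp
    then show ?thesis using d 2 by (intro interpolable_reduce[OF s]) simp_all
  next
    case 3
    then show ?thesis using interpolable_degree_Suc[OF 3(1) Q k(1)] s by simp
  next
    case 4
    have "congruence_preserving_on {h. degree h < degree Q + 1} (Q ^ k) s"
      using s 4 by (auto simp: congruence_preserving_on_def)
    then have "interpolable {h. degree h < degree Q + 1} (Q ^ k) s"
      using interpolable_degree_Suc[OF 4(1) Q k(1)] by simp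
    \<comment> \<open>For linear \<open>Q\<close> the square has degree
      \<open>2 = degree Q + 1\<close>, so reduction modulo \<open>Q ^ 2\<close> leads back to the
      range just treated.\<close>
    moreover have "min n (degree (Q ^ k)) = degree Q + 1" using 4 unfolding deg by simp
    ultimately show ?thesis using d k by (intro interpolable_reduce[OF s]) (auto simp: deg)
  qed
qed

lemma not_interpolable_above_gamma:
  fixes Q g :: "'a::{field, finite} poly"
  assumes Q: "irreducible Q" and g: "g \<noteq> 0" "Q ^ k dvd g" and k: "k \<ge> 1"
    and n: "gamma_prime_power Q k \<le> enat n"
  shows "\<exists>s. congruence_preserving_on {h. degree h < n} g s
           \<and> \<not> interpolable {h. degree h < n} g s"
proof -
  have d: "degree Q > 0" using Q by (rule irreducible_degree_pos)
  then have Q0: "Q \<noteq> 0" by auto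
  have k2: "k \<ge> 2" using n k by (auto simp: gamma_prime_power_def split: if_splits)
  then have sq: "Q ^ 2 dvd g" using g(2) le_imp_power_dvd dvd_trans by blast
  have ndvd: "\<not> Q dvd c" if "c \<noteq> 0" "degree c < degree Q" for c
    using that dvd_imp_degree_le[of Q c] by auto
  show ?thesis
  proof (cases "CARD('a) = 2")
    case False
    \<comment> \<open>With more than two scalars, a constant \<open>c\<close> other than 0 and 1
      serves, and \<open>c * Q\<close> has the degree of \<open>Q\<close>.\<close>
    have "card {0, 1 :: 'a} = 2" by simp
    then have "{0, 1 :: 'a} \<noteq> UNIV" using False by metis
    then obtain c :: 'a where c: "c \<noteq> 0" "c \<noteq> 1" by auto
    have "\<not> Q dvd [:c:]" "\<not> Q dvd [:c:] - 1"
      by (rule ndvd; use c d in \<open>simp add: one_pCons\<close>)+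
    moreover have "degree Q < n"
      using n False k2 by (auto simp: gamma_prime_power_def)
    ultimately show ?thesis
      using c by (intro not_interpolable_square_dvd[OF Q g(1) sq, of "[:c:]"]) auto
  next
    case True
    \<comment> \<open>For linear \<open>Q\<close> over two elements the exponents 1 and 2 have
      infinite value, which leaves \<open>k \<ge> 3\<close>.\<close>
    have n': "degree Q + 2 \<le> n" and k': "degree Q = 1 \<Longrightarrow> k \<ge> 3"
      using n True k2 by (auto simp: gamma_prime_power_def split: if_splits)
    show ?thesis
    proof (cases "degree Q = 1")
      case False
      \<comment> \<open>Now \<open>c\<close> is the variable \<open>t\<close>; the degree of
        \<open>t * Q\<close> accounts for the bound being larger by one than for more
        scalars.\<close>
      then have "\<not> Q dvd [:0, 1:]" "\<not> Q dvd [:0, 1:] - 1"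
        by - (rule ndvd; use False d in \<open>simp add: one_pCons\<close>)+
      moreover have "degree ([:0, 1:] * Q) = degree Q + 1" using Q0 by (subst degree_mult_eq) auto
      ultimately show ?thesis
        using n' by (intro not_interpolable_square_dvd[OF Q g(1) sq, of "[:0, 1:]"]) auto
    next
      case 1: True
      have "Q ^ 3 dvd g" using g(2) k'[OF 1] le_imp_power_dvd dvd_trans by blast
      moreover have "(1 :: 'a) + 1 = 0"
        using card2_eq_0_or_1[OF True, of "1 + 1"] by (metis add_cancel_right_right zero_neq_one)
      moreover have "degree (Q ^ 2) = 2" using 1 Q0 by (simp add: degree_power_eq)
      moreover have "degree (Q + Q ^ 2) \<le> 2" using 1 calculation by (intro degree_add_le) auto
      ultimately show ?thesis
        using n' 1 by (intro not_interpolable_cube_dvd[OF Q g(1)]) auto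
    qed
  qed
qed

theorem theorem1p8:
  fixes f g :: "'a::{field, finite} poly"
  assumes "degree f > 0" and "degree g > 0"
  shows "Chen_pair f g \<longleftrightarrow> enat (degree f) < gamma g"
proof -
  let ?R = "{h. degree h < degree f}"
  have g0: "g \<noteq> 0" using assms(2) by auto
  show ?thesis
    unfolding Chen_pair_iff[OF assms(1)] less_gamma_iff[OF assms(2)]
  proof (intro iffI ballI allI impI)
    fix x
    assume Chen: "\<forall>s. congruence_preserving_on ?R g s \<longrightarrow> interpolable ?R g s"
      and "x \<in> prime_power_factors g"
    then obtain Q k where "x = (Q, k)" "irreducible Q" "k \<ge> 1" "Q ^ k dvd g"
      by (auto simp: prime_power_factors_def)
    then show "case x of (Q, k) \<Rightarrow> enat (degree f) < gamma_prime_power Q k"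
      using not_interpolable_above_gamma[of Q g k "degree f"] Chen g0 by (auto simp: not_less[symmetric])
  next
    fix s
    assume less: "\<forall>(Q, k)\<in>prime_power_factors g. enat (degree f) < gamma_prime_power Q k"
      and s: "congruence_preserving_on ?R g s"
    show "interpolable ?R g s"
      using g0
    proof (rule interpolable_if_prime_powers)
      fix Q :: "'a poly" and k :: nat
      assume Q: "irreducible Q" "lead_coeff Q = 1" and k: "k \<ge> 1" and dvd: "Q ^ k dvd g"
      \<comment> \<open>\<open>Q ^ k\<close> may be a proper part of the \<open>Q\<close>-power in
        \<open>g\<close>; the bound is available at the exact exponent
        \<open>e \<ge> k\<close>.\<close>
      obtain e m where gm: "g = Q ^ e * m" and m: "\<not> Q dvd m"
        using irreducible_exact_power[OF Q(1) g0] .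
      note exact = irreducible_power_dvd_exact[OF Q(1) m]
      have ke: "k \<le> e" using dvd exact by (simp add: gm)
      then have "(Q, e) \<in> prime_power_factors g"
        using Q k exact by (simp add: prime_power_factors_def gm del: power_Suc)
      then have "enat (degree f) < gamma_prime_power Q e" using less by blast
      then show "interpolable ?R (Q ^ k) s"
        using Q(1) k ke congruence_preserving_on_dvd[OF s dvd]
        by (intro interpolable_below_gamma) auto
    qed
  qed
qed

end
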